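(* Let $K\ge1$ be an integer, let $\nu_1,\dots,\nu_K$ be probability distributions supported on $[0,1]$ with means $\mu_i$ and variances $\sigma_i^2$, let $D=[0,1]\times[0,1]$, and let $f:D\to\mathbb{R}$ be a (not necessarily continuous) function such that for each arm $i$ there exists $\varepsilon>0$ for which $f$ is continuous in $B_i(\varepsilon)=\{(x,y)\in D:|x-\mu_i|+|y-\sigma_i^2|\le\varepsilon\}$. Let $e_i=\sup\{\varepsilon>0: f\text{ is continuous in }B_i(\varepsilon)\}$, which equals the $\ell_1$-distance $d_\Omega(\mu_i,\sigma_i^2)$ from $(\mu_i,\sigma_i^2)$ to the set of discontinuities of $f$. For each $i$ let $\varphi_i:\mathbb{R}_+\to\mathbb{R}_+$ be strictly increasing with $\varphi_i(0)=0$ and $|f(\mathbf{x}_2)-f(\mathbf{x}_1)|\le\varphi_i(\|\mathbf{x}_2-\mathbf{x}_1\|_1)$ for all $\mathbf{x}_1,\mathbf{x}_2\in B_i(e_i)$. Let $f_i=f(\mu_i,\sigma_i^2)$, $i^\star\in\operatorname{argmin}_i f_i$ and $\Delta_i=f_i-f_{i^\star}$. Then for every integer $n\ge 1$ and every $\delta\in(0,\frac1{4Kn})$ with $n\ge\sum_{i=1}^K162\,e_i^{-2}\ln\frac1\delta$, with probability at least $1-4Kn\delta$ the regret $\mathcal{R}_n$ at time $n$ of the $\varphi$-LCB2 algorithm run with confidence level $\delta$ satisfies \[ \mathcal{R}_n\le\sum_{i:\Delta_i>0}\Delta_i\left(162\,e_i^{-2}+\frac{18}{(\varphi_i^{-1}(\Delta_i/2))^2}\right)\ln\frac1\delta+\sum_{i:\Delta_i>0}\Delta_i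 . \] Moreover, if the algorithm is run with $\delta=\frac1{n^2}$ and $n\ge\sum_{i=1}^K324\,e_i^{-2}\ln n$, then with probability at least $1-\frac{4K}{n}$, \[ \mathcal{R}_n\le\sum_{i:\Delta_i>0}\Delta_i\left(324\,e_i^{-2}+\frac{36}{(\varphi_i^{-1}(\Delta_i/2))^2}\right)\ln n+\sum_{i:\Delta_i>0}\Delta_i . \]
   Context: Stochastic bandit setting. There are $K$ arms with distributions $\nu_1,\dots,\nu_K$ on $[0,1]$. For each arm $i$, $X_{i,1},X_{i,2},\dots$ are i.i.d. samples from $\nu_i$. At each time step $t=1,\dots,n$ the learner chooses an arm $a_t\in\{1,\dots,K\}$ based on past observations and observes $X_{a_t,T_{a_t}(t)}$, where $T_i(t)=\sum_{s=1}^{t}\mathbb{I}[a_s=i]$ is the number of pulls of arm $i$ up to and including time $t$. Regret: $\mathcal{R}_n=\sum_{t=1}^n f_{a_t}-n f_{i^\star}$, a random variable. Empirical mean and variance of arm $i$ after $t\ge1$ pulls: \[ \widehat\mu_{i,t}=\frac1t\sum_{s=1}^tX_{i,s},\qquad \widehat\sigma^2_{i,t}=\frac1t\sum_{s=1}^t(X_{i,s}-\widehat\mu_{i,t})^2 . \] Distance to discontinuities: $\Omega_f\subseteq D$ is the set of discontinuity points of $f$, and $d_\Omega(x,y)=\inf_{(z_1,z_2)\in\Omega_f}\{|z_1-x|+|z_2-y|\}$. If $\Omega_f=\emptyset$, then $d_\Omega=+\infty$, $e_i=+\infty$, $e_i^{-2}=0$ and $B_i(e_i)=D$. The $\varphi$-LCB2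 algorithm with confidence level $\delta$ (stopped after $n$ total time steps): Phase I. For arms $i=1,2,\dots,K$ in order: pull arm $i$ repeatedly (at least once) until the number $m$ of pulls of arm $i$ so far satisfies \[ 6\sqrt{\frac{\ln\frac1\delta}{2m}}\le\frac12\,d_\Omega(\widehat\mu_{i,m},\widehat\sigma^2_{i,m}). \] Phase II. At each remaining time step $t$ up to $n$, choose \[ a_t\in\operatorname{argmin}_{i=1,\dots,K}\left[f\big(\widehat\mu_{i,T_i(t-1)},\widehat\sigma^2_{i,T_i(t-1)}\big)-\varphi_i\left(6\sqrt{\frac{\ln\frac1\delta}{2\,T_i(t-1)}}\right)\right], \] with ties broken arbitrarily. Inverse of $\varphi_i$: for $y>0$, $\varphi_i^{-1}(y)=\inf\{z\ge0:\varphi_i(z)\ge y\}$ (with $\inf\emptyset=+\infty$ and $1/(+\infty)^2=0$), which is the ordinary inverse whenever $y$ is in the range of $\varphi_i$. A term with $\varphi_i^{-1}(\Delta_i/2)=0$ is read as $+\infty$. $\mathbb{R}_+=[0,\infty)$. *)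

theory Defs
  imports "HOL-Probability.Probability"
begin

definition D :: "(real \<times> real) set"
  where "D = {0..1} \<times> {0..1}"

definition l1_dist :: "real \<times> real \<Rightarrow> real \<times> real \<Rightarrow> real"
  where "l1_dist p q = \<bar>fst p - fst q\<bar> + \<bar>snd p - snd q\<bar>"

definition mean_var :: "real measure \<Rightarrow> real \<times> real"
  where "mean_var \<nu> = (\<integral>x. x \<partial>\<nu>, \<integral>x. (x - (\<integral>y. y \<partial>\<nu>))\<^sup>2 \<partial>\<nu>)"

text \<open>
  The objective is a total function on pairs of reals, but only its restriction to \<^term>\<open>D\<close>
  is meant; continuity is always relative to \<^term>\<open>D\<close>.  Radii and distances are extended
  reals: the infimum of the empty set is \<^term>\<open>\<infinity>::ereal\<close>, and
  \<^term>\<open>l1_ball p \<infinity> = D\<close>.  Likewise \<^prop>\<open>1 / (\<infinity>::ereal)\<^sup>2 = 0\<close> and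
  \<^prop>\<open>1 / (0::ereal)\<^sup>2 = \<infinity>\<close>.
\<close>

definition l1_ball :: "real \<times> real \<Rightarrow> ereal \<Rightarrow> (real \<times> real) set"
  where "l1_ball p r = {q \<in> D. ereal (l1_dist q p) \<le> r}"

definition disc :: "(real \<times> real \<Rightarrow> real) \<Rightarrow> (real \<times> real) set"
  where "disc f = {z \<in> D. \<not> continuous (at z within D) f}"

definition disc_dist :: "(real \<times> real \<Rightarrow> real) \<Rightarrow> real \<times> real \<Rightarrow> ereal"
  where "disc_dist f p = (INF z \<in> disc f. ereal (l1_dist z p))"

definition cont_radius :: "(real \<times> real \<Rightarrow> real) \<Rightarrow> real \<times> real \<Rightarrow> ereal"
  where "cont_radius f p =
    Sup (ereal ` {\<epsilon>. 0 < \<epsilon> \<and> continuous_on (l1_ball p (ereal \<epsilon>)) f})"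

definition gen_inv :: "(real \<Rightarrow> real) \<Rightarrow> real \<Rightarrow> ereal"
  where "gen_inv \<phi> y = Inf (ereal ` {z. 0 \<le> z \<and> y \<le> \<phi> z})"

text \<open>
  A reward table for one outcome is a function \<^term>\<open>x :: nat \<Rightarrow> nat \<Rightarrow> real\<close>, where
  \<^term>\<open>x i s\<close> is the reward of the \<^term>\<open>s\<close>-th pull of arm \<^term>\<open>i\<close>
  (\<^prop>\<open>s \<ge> 1\<close>), and \<^term>\<open>a :: nat \<Rightarrow> nat\<close> is the sequence of chosen arms, indexed
  by time steps from 1 on.
\<close>

definition emp_mean :: "(nat \<Rightarrow> nat \<Rightarrow> real) \<Rightarrow> nat \<Rightarrow> nat \<Rightarrow> real"
  where "emp_mean x i t = (\<Sum>s=1..t. x i s) / real t"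

definition emp_var :: "(nat \<Rightarrow> nat \<Rightarrow> real) \<Rightarrow> nat \<Rightarrow> nat \<Rightarrow> real"
  where "emp_var x i t = (\<Sum>s=1..t. (x i s - emp_mean x i t)\<^sup>2) / real t"

definition emp :: "(nat \<Rightarrow> nat \<Rightarrow> real) \<Rightarrow> nat \<Rightarrow> nat \<Rightarrow> real \<times> real"
  where "emp x i t = (emp_mean x i t, emp_var x i t)"

definition pulls :: "(nat \<Rightarrow> nat) \<Rightarrow> nat \<Rightarrow> nat \<Rightarrow> nat"
  where "pulls a i t = card {s \<in> {1..t}. a s = i}"

definition conf :: "real \<Rightarrow> nat \<Rightarrow> real"
  where "conf \<delta> m = 6 * sqrt (ln (1 / \<delta>) / (2 * real m))"

text \<open>
  Phase I of arm \<^term>\<open>i\<close> is over as soon as its stopping test has succeeded for some earlier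
  number \<^prop>\<open>m \<ge> 1\<close> of pulls.  The test need not stay true when the arm is pulled again in
  Phase II, hence the existential quantifier.
\<close>

definition explored ::
  "(real \<times> real \<Rightarrow> real) \<Rightarrow> real \<Rightarrow> (nat \<Rightarrow> nat \<Rightarrow> real) \<Rightarrow> nat \<Rightarrow> nat \<Rightarrow> bool"
  where "explored f \<delta> x i k \<longleftrightarrow>
    (\<exists>m \<in> {1..k}. ereal (conf \<delta> m) \<le> ereal (1/2) * disc_dist f (emp x i m))"

text \<open>
  Admissible choice at time \<^term>\<open>t\<close>.  Since the arms are processed in increasing order, the arm
  currently being processed in Phase I is the least one whose Phase I is not over.  In Phase II any
  minimiser of the index may be chosen.
\<close>

definition lcb2_step ::
  "nat \<Rightarrow> (real \<times> real \<Rightarrow> real) \<Rightarrow> (nat \<Rightarrow> real \<Rightarrow> real) \<Rightarrow> real \<Rightarrow>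
   (nat \<Rightarrow> nat \<Rightarrow> real) \<Rightarrow> (nat \<Rightarrow> nat) \<Rightarrow> nat \<Rightarrow> bool"
  where "lcb2_step K f \<phi> \<delta> x a t \<longleftrightarrow>
    (if \<exists>i \<in> {1..K}. \<not> explored f \<delta> x i (pulls a i (t - 1))
     then a t = (LEAST i. i \<in> {1..K} \<and> \<not> explored f \<delta> x i (pulls a i (t - 1)))
     else is_arg_min
            (\<lambda>i. f (emp x i (pulls a i (t - 1))) - \<phi> i (conf \<delta> (pulls a i (t - 1))))
            (\<lambda>i. i \<in> {1..K}) (a t))"

text \<open>
  The algorithm run for \<^term>\<open>n\<close> steps on the random reward table \<^term>\<open>X\<close>.  As ties are
  broken arbitrarily, \<^term>\<open>A\<close> is any choice of arms obeying the rule at every outcome; the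
  tie-breaking may depend on past observations or on external randomness.
\<close>

definition lcb2_run ::
  "'w measure \<Rightarrow> nat \<Rightarrow> (real \<times> real \<Rightarrow> real) \<Rightarrow> (nat \<Rightarrow> real \<Rightarrow> real) \<Rightarrow> real \<Rightarrow>
   (nat \<Rightarrow> nat \<Rightarrow> 'w \<Rightarrow> real) \<Rightarrow> nat \<Rightarrow> (nat \<Rightarrow> 'w \<Rightarrow> nat) \<Rightarrow> bool"
  where "lcb2_run M K f \<phi> \<delta> X n A \<longleftrightarrow>
    (\<forall>\<omega> \<in> space M. \<forall>t \<in> {1..n}. lcb2_step K f \<phi> \<delta> (\<lambda>i s. X i s \<omega>) (\<lambda>s. A s \<omega>) t)"

definition regret :: "(nat \<Rightarrow> real) \<Rightarrow> nat \<Rightarrow> nat \<Rightarrow> (nat \<Rightarrow> nat) \<Rightarrow> real"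
  where "regret v istar n a = (\<Sum>t=1..n. v (a t)) - real n * v istar"

text \<open>
  ``With probability at least \<^term>\<open>p\<close>, \<^term>\<open>P\<close> holds.''  Neither the objective nor the
  tie-breaking is assumed measurable, so the set of outcomes satisfying \<^term>\<open>P\<close> need not be an
  event; it is required to contain an event of probability at least \<^term>\<open>p\<close>.  For an event this
  is the usual meaning, as the lemma below shows.
\<close>

definition holds_with_prob :: "'w measure \<Rightarrow> real \<Rightarrow> ('w \<Rightarrow> bool) \<Rightarrow> bool"
  where "holds_with_prob M p P \<longleftrightarrow>
    (\<exists>E \<in> sets M. p \<le> measure M E \<and> (\<forall>\<omega> \<in> E. P \<omega>))"

lemma holds_with_prob_iff:
  assumes "prob_space M" and "{\<omega> \<in> space M. P \<omega>} \<in> sets M"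
  shows "holds_with_prob M p P \<longleftrightarrow> p \<le> measure M {\<omega> \<in> space M. P \<omega>}"
proof
  interpret prob_space M by fact
  assume "holds_with_prob M p P"
  then obtain E where E: "E \<in> sets M" "p \<le> measure M E" "\<forall>\<omega> \<in> E. P \<omega>"
    unfolding holds_with_prob_def by blast
  have "E \<subseteq> {\<omega> \<in> space M. P \<omega>}"
    using E sets.sets_into_space by blast
  then have "measure M E \<le> measure M {\<omega> \<in> space M. P \<omega>}"
    using assms(2) by (rule finite_measure_mono)
  then show "p \<le> measure M {\<omega> \<in> space M. P \<omega>}"
    using E(2) by simp
next
  assume "p \<le> measure M {\<omega> \<in> space M. P \<omega>}"
  then show "holds_with_prob M p P"
    using assms(2) unfolding holds_with_prob_def by blast
qed

end

theory Submission
  imports Defs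
begin

text \<open>
  Hoeffding's inequality for \<open>X\<close> and for \<open>(X - \<mu>)\<^sup>2\<close>, with a union bound over arms and pull counts,
  gives an event of probability at least \<open>1 - 4Kn\<delta>\<close> on which every empirical pair
  \<open>(\<mu>\<^sub>m, \<sigma>\<^sup>2\<^sub>m)\<close> is within \<open>3 c\<^sub>m\<close> of its target, where \<open>c\<^sub>m = sqrt (ln (1 / \<delta>) / (2 m))\<close> and
  \<open>6 c\<^sub>m\<close> is the confidence radius.  On this event an arm still explored after \<open>m \<ge> 1\<close> pulls has
  \<open>e < 15 c\<^sub>m\<close>, hence \<open>m < 162 ln (1 / \<delta>) / e\<^sup>2\<close>; once its exploration is over, \<open>e \<ge> 9 c\<^sub>m\<close>, so that
  the modulus \<open>\<phi>\<close> applies and a suboptimal arm is chosen only if \<open>\<Delta> \<le> 2 \<phi> (6 c\<^sub>m)\<close>, i.e. only if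
  \<open>m \<le> 18 ln (1 / \<delta>) / (\<phi>\<inverse> (\<Delta> / 2))\<^sup>2\<close>.  Either bound holds just before a pull, which
  costs the additional \<open>+ 1\<close>.
\<close>

section \<open>Distance to the discontinuities\<close>

lemma l1_dist_triangle: "l1_dist p r \<le> l1_dist p q + l1_dist q r"
  unfolding l1_dist_def by linarith

lemma l1_dist_commute: "l1_dist p q = l1_dist q p"
  unfolding l1_dist_def by linarith

lemma l1_dist_nonneg: "0 \<le> l1_dist p q"
  unfolding l1_dist_def by simp

lemma l1_dist_self [simp]: "l1_dist p p = 0"
  unfolding l1_dist_def by simp

text \<open>An infimum of 1-Lipschitz functions is 1-Lipschitz. Subtracting the finite
  \<open>l1_dist q p\<close> on the left reduces the claim to one discontinuity at a time and also
  covers an empty \<open>disc f\<close>, where the distance is infinite.\<close>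

lemma disc_dist_triangle: "disc_dist f p \<le> disc_dist f q + ereal (l1_dist q p)"
proof -
  have "disc_dist f p - ereal (l1_dist q p) \<le> disc_dist f q"
    unfolding disc_dist_def
  proof (rule INF_greatest)
    fix z assume z: "z \<in> disc f"
    have "(INF z\<in>disc f. ereal (l1_dist z p)) \<le> ereal (l1_dist z p)"
      using z by (rule INF_lower)
    also have "\<dots> \<le> ereal (l1_dist z q) + ereal (l1_dist q p)"
      using l1_dist_triangle by simp
    finally show "(INF z\<in>disc f. ereal (l1_dist z p)) - ereal (l1_dist q p) \<le> ereal (l1_dist z q)"
      by (simp add: ereal_minus_le)
  qed
  then show ?thesis
    by (simp add: ereal_minus_le)
qed

lemma disc_dist_nonneg: "0 \<le> disc_dist f p"
  unfolding disc_dist_def by (rule INF_greatest) (simp add: l1_dist_nonneg)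

text \<open>The strict inequality keeps the closed ball, boundary included, away from
  \<open>disc f\<close>. Continuity relative to \<open>D\<close> then restricts to the ball.\<close>

lemma continuous_on_l1_ball:
  assumes "ereal \<epsilon> < disc_dist f p"
  shows "continuous_on (l1_ball p (ereal \<epsilon>)) f"
proof (rule continuous_on_subset)
  have "continuous (at q within D) f" if "q \<in> l1_ball p (ereal \<epsilon>)" for q
  proof (rule ccontr)
    assume "\<not> ?thesis"
    then have "q \<in> disc f"
      using that by (simp add: disc_def l1_ball_def)
    then have "disc_dist f p \<le> ereal (l1_dist q p)"
      unfolding disc_dist_def by (rule INF_lower)
    with assms that show False
      by (auto simp: l1_ball_def dest: less_le_trans)
  qed
  then have "continuous (at q within l1_ball p (ereal \<epsilon>)) f" if "q \<in> l1_ball p (ereal \<epsilon>)" for q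
    using that by (rule_tac continuous_within_subset[of _ D]) (auto simp: l1_ball_def)
  then show "continuous_on (l1_ball p (ereal \<epsilon>)) f"
    by (simp add: continuous_on_eq_continuous_within)
qed simp

text \<open>
  Points on the boundary of the ball may be discontinuities of \<open>f\<close> relative to \<open>D\<close>; only the
  interior points, at which the ball is a neighbourhood in \<open>D\<close>, are excluded.
\<close>

lemma disc_dist_ge_radius:
  assumes "continuous_on (l1_ball p (ereal \<epsilon>)) f"
  shows "ereal \<epsilon> \<le> disc_dist f p"
  unfolding disc_dist_def
proof (rule INF_greatest, rule ccontr)
  fix z assume z: "z \<in> disc f" and "\<not> ereal \<epsilon> \<le> ereal (l1_dist z p)"
  then have less: "l1_dist z p < \<epsilon>" by simp
  define U where "U = {q. l1_dist q p < \<epsilon>}"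
  have "open U"
    unfolding U_def l1_dist_def by (intro open_Collect_less continuous_intros)
  have zU: "z \<in> D \<inter> U" using z less by (simp add: U_def disc_def)
  have "continuous_on (D \<inter> U) f"
    using assms by (rule continuous_on_subset) (auto simp: U_def l1_ball_def)
  then have "continuous (at z within D \<inter> U) f"
    using zU by (simp add: continuous_on_eq_continuous_within)
  moreover have "at z within D \<inter> U = at z within D"
    by (rule at_within_nhd[where S = U]) (use \<open>open U\<close> zU in auto)
  ultimately show False
    using z by (simp add: disc_def)
qed

text \<open>Some positive radius must be assumed: otherwise the supremum is taken over the empty set
  and equals \<open>-\<infinity>\<close>, whereas \<open>disc_dist\<close> is nonnegative.\<close>

lemma cont_radius_eq_disc_dist:
  assumes "0 < \<epsilon>" "continuous_on (l1_ball p (ereal \<epsilon>)) f"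
  shows "cont_radius f p = disc_dist f p"
proof (rule antisym)
  show "cont_radius f p \<le> disc_dist f p"
    unfolding cont_radius_def by (rule Sup_least) (auto intro: disc_dist_ge_radius)
  show "disc_dist f p \<le> cont_radius f p"
  proof (rule ccontr)
    assume "\<not> ?thesis"
    \<comment> \<open>A real strictly between the two values would itself be a radius of continuity,
      so it could not exceed the supremum.\<close>
    then obtain r where r: "cont_radius f p < ereal r" "ereal r < disc_dist f p"
      using ereal_dense2[of "cont_radius f p" "disc_dist f p"] by (meson not_le)
    have "ereal \<epsilon> \<le> cont_radius f p"
      unfolding cont_radius_def using assms by (intro Sup_upper) auto
    also note r(1)
    finally have "0 < r"
      using \<open>0 < \<epsilon>\<close> by simp
    then have "ereal r \<le> cont_radius f p"
      unfolding cont_radius_def using continuous_on_l1_ball[OF r(2)] by (intro Sup_upper) auto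
    with r(1) show False by simp
  qed
qed

section \<open>Deterministic analysis\<close>

lemma gen_inv_nonneg: "0 \<le> gen_inv \<phi> y"
  unfolding gen_inv_def by (rule Inf_greatest) auto

lemma gen_inv_le: "0 \<le> z \<Longrightarrow> y \<le> \<phi> z \<Longrightarrow> gen_inv \<phi> y \<le> ereal z"
  unfolding gen_inv_def by (rule Inf_lower) auto

text \<open>Common form of both pull-count bounds, with \<open>g\<close> the distance to the
  discontinuities or the inverse modulus, and \<open>c\<close> a multiple of the confidence radius.
  If \<open>g = 0\<close>, the right-hand side is infinite, as the convention demands.\<close>

lemma le_ereal_const_div_square_mult:
  fixes g :: ereal
  assumes "0 \<le> g" "g \<le> ereal c" "0 < L" "0 < C" "m * c\<^sup>2 \<le> C * L" "0 \<le> m"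
  shows "ereal m \<le> ereal C / g\<^sup>2 * ereal L"
proof (cases "g = 0")
  case True
  then have "ereal C / g\<^sup>2 * ereal L = \<infinity>"
    using assms by (simp add: divide_ereal_def power2_eq_square)
  then show ?thesis by simp
next
  case False
  then obtain r where r: "g = ereal r" "0 < r" "r \<le> c"
    using assms(1,2) by (cases g) (auto simp: zero_ereal_def)
  have "m * r\<^sup>2 \<le> m * c\<^sup>2"
    using r assms by (intro mult_left_mono power_mono) auto
  then have "m \<le> C / r\<^sup>2 * L"
    using assms(5) r by (simp add: field_simps)
  then show ?thesis using r by simp
qed

text \<open>Source of the constants: 36 / 2 = 18, and a radius of \<open>3 * conf \<delta> m\<close>
  gives 9 * 18 = 162.\<close>

lemma conf_square: "m \<ge> 1 \<Longrightarrow> 0 < \<delta> \<Longrightarrow> \<delta> < 1 \<Longrightarrow> real m * (conf \<delta> m)\<^sup>2 = 18 * ln (1 / \<delta>)"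
  unfolding conf_def by (simp add: power_mult_distrib)

lemma conf_pos: "m \<ge> 1 \<Longrightarrow> 0 < \<delta> \<Longrightarrow> \<delta> < 1 \<Longrightarrow> 0 < conf \<delta> m"
  unfolding conf_def by simp

lemma conf_antimono:
  assumes "1 \<le> k" "k \<le> m" "0 < \<delta>" "\<delta> < 1"
  shows "conf \<delta> m \<le> conf \<delta> k"
proof -
  have "ln (1 / \<delta>) / (2 * real m) \<le> ln (1 / \<delta>) / (2 * real k)"
    using assms by (intro divide_left_mono) auto
  then show ?thesis
    unfolding conf_def by simp
qed

section \<open>Pull counts and the decomposition of the regret\<close>

lemma pulls_Suc: "pulls a i (Suc t) = pulls a i t + (if a (Suc t) = i then 1 else 0)"
proof -
  have "{s \<in> {1..Suc t}. a s = i} = {s \<in> {1..t}. a s = i} \<union> (if a (Suc t) = i then {Suc t} else {})"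
    by (auto simp: le_Suc_eq)
  then show ?thesis
    unfolding pulls_def by (auto simp: card_insert_if)
qed

lemma pulls_le: "pulls a i t \<le> t"
proof -
  have "card {s \<in> {1..t}. a s = i} \<le> card {1..t}"
    by (rule card_mono) auto
  then show ?thesis by (simp add: pulls_def)
qed

text \<open>The time steps are grouped by the arm chosen.\<close>

lemma regret_eq_sum_pulls:
  assumes "\<And>t. t \<in> {1..n} \<Longrightarrow> a t \<in> {1..K}"
  shows "regret v istar n a = (\<Sum>i=1..K. (v i - v istar) * real (pulls a i n))"
proof -
  have "regret v istar n a = (\<Sum>t=1..n. v (a t) - v istar)"
    by (simp add: regret_def sum_subtractf)
  also have "\<dots> = (\<Sum>i=1..K. \<Sum>t\<in>{t\<in>{1..n}. a t = i}. v (a t) - v istar)"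
    using assms by (intro sum.group[symmetric]) auto
  also have "\<dots> = (\<Sum>i=1..K. (v i - v istar) * real (pulls a i n))"
    by (simp add: pulls_def mult.commute)
  finally show ?thesis .
qed

section \<open>Pull-count bounds for one outcome\<close>

text \<open>A fixed outcome in the concentration event: \<open>p i\<close> is the pair of true mean
  and variance, and \<open>concentrated\<close> is all that remains of the probability. The modulus
  is stated only against the centre of the ball, the one comparison that the analysis makes.\<close>

locale concentrated_lcb2 =
  fixes K :: nat and f :: "real \<times> real \<Rightarrow> real" and \<phi> :: "nat \<Rightarrow> real \<Rightarrow> real"
    and p :: "nat \<Rightarrow> real \<times> real" and \<delta> :: real and n :: nat
    and x :: "nat \<Rightarrow> nat \<Rightarrow> real" and a :: "nat \<Rightarrow> nat" and istar :: nat
  assumes \<delta>: "0 < \<delta>" "\<delta> < 1"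
    and target_in_D: "\<And>i. i \<in> {1..K} \<Longrightarrow> p i \<in> D"
    and disc_dist_pos: "\<And>i. i \<in> {1..K} \<Longrightarrow> 0 < disc_dist f (p i)"
    and strict_mono: "\<And>i. i \<in> {1..K} \<Longrightarrow> strict_mono_on {0..} (\<phi> i)"
    and modulus: "\<And>i q. i \<in> {1..K} \<Longrightarrow> q \<in> l1_ball (p i) (disc_dist f (p i)) \<Longrightarrow>
           \<bar>f q - f (p i)\<bar> \<le> \<phi> i (l1_dist q (p i))"
    and concentrated: "\<And>i m. i \<in> {1..K} \<Longrightarrow> m \<in> {1..n} \<Longrightarrow>
           emp x i m \<in> D \<and> l1_dist (emp x i m) (p i) \<le> conf \<delta> m / 2"
    and step: "\<And>t. t \<in> {1..n} \<Longrightarrow> lcb2_step K f \<phi> \<delta> x a t"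
    and istar: "is_arg_min (\<lambda>i. f (p i)) (\<lambda>i. i \<in> {1..K}) istar"
begin

text \<open>The Phase I and Phase II bounds are added: both are nonnegative, so the sum dominates
  each, and one bound serves every pull.\<close>

definition pull_bound :: "nat \<Rightarrow> ereal"
  where "pull_bound i = (162 * (1 / (disc_dist f (p i))\<^sup>2)
    + 18 / (gen_inv (\<phi> i) ((f (p i) - f (p istar)) / 2))\<^sup>2) * ereal (ln (1 / \<delta>))"

lemma ln_pos: "0 < ln (1 / \<delta>)"
  using \<delta> by simp

lemma inverse_square_nonneg: "0 \<le> 1 / (e :: ereal)\<^sup>2" "0 \<le> 18 / (e :: ereal)\<^sup>2"
  by (cases e; simp)+

lemma exploration_le_pull_bound: "162 * (1 / (disc_dist f (p i))\<^sup>2) * ereal (ln (1 / \<delta>)) \<le> pull_bound i"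
  unfolding pull_bound_def using ln_pos
  by (intro ereal_mult_right_mono add_increasing2 ereal_0_le_mult inverse_square_nonneg) auto

lemma exploitation_le_pull_bound:
  "18 / (gen_inv (\<phi> i) ((f (p i) - f (p istar)) / 2))\<^sup>2 * ereal (ln (1 / \<delta>)) \<le> pull_bound i"
  unfolding pull_bound_def using ln_pos
  by (intro ereal_mult_right_mono add_increasing ereal_0_le_mult inverse_square_nonneg) auto

lemma pull_bound_nonneg: "0 \<le> pull_bound i"
  unfolding pull_bound_def using ln_pos
  by (intro ereal_0_le_mult add_nonneg_nonneg inverse_square_nonneg) auto

text \<open>The test fails in particular at the current count \<open>m\<close>, so the empirical
  pair is close to a discontinuity; by concentration the true pair is close to it too. Before the
  first pull there is no test, and nonnegativity of the bound suffices.\<close>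

lemma unexplored_pulls_le:
  assumes i: "i \<in> {1..K}" and m: "m \<le> n" and unexplored: "\<not> explored f \<delta> x i m"
  shows "ereal (real m) \<le> pull_bound i"
proof (cases "m = 0")
  case True
  then show ?thesis using pull_bound_nonneg by (simp add: zero_ereal_def[symmetric])
next
  case False
  then have m: "m \<in> {1..n}" using assms by simp
  have "ereal (1/2) * disc_dist f (emp x i m) \<le> ereal (conf \<delta> m)"
    using unexplored m unfolding explored_def
    by (meson atLeastAtMost_iff linear order_refl)
  then have "disc_dist f (emp x i m) \<le> ereal (2 * conf \<delta> m)"
    by (cases "disc_dist f (emp x i m)") auto
  moreover have "disc_dist f (p i) \<le> disc_dist f (emp x i m) + ereal (l1_dist (emp x i m) (p i))"
    by (rule disc_dist_triangle)
  ultimately have "disc_dist f (p i) \<le> ereal (2 * conf \<delta> m) + ereal (conf \<delta> m / 2)"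
    using concentrated[OF i m] by (meson add_mono ereal_less_eq(3) order_trans)
  \<comment> \<open>2 + 1/2 is rounded up to 3, whose square turns 18 into 162.\<close>
  also have "\<dots> \<le> ereal (3 * conf \<delta> m)"
    using conf_pos[of m \<delta>] m \<delta> by simp
  finally have le: "disc_dist f (p i) \<le> ereal (3 * conf \<delta> m)" .
  have "ereal (real m) \<le> ereal 162 / (disc_dist f (p i))\<^sup>2 * ereal (ln (1 / \<delta>))"
    using disc_dist_nonneg le ln_pos
    by (rule le_ereal_const_div_square_mult)
       (use conf_square[of m \<delta>] m \<delta> in \<open>simp_all add: power_mult_distrib\<close>)
  also have "\<dots> = 162 * (1 / (disc_dist f (p i))\<^sup>2) * ereal (ln (1 / \<delta>))"
    by (simp add: divide_ereal_def)
  also note exploration_le_pull_bound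
  finally show ?thesis .
qed

text \<open>The test succeeded at some earlier count \<open>k\<close> and may fail at
  \<open>m\<close>. Its success bounds the true distance to the discontinuities from below once and
  for all; since confidence radii shrink, the later empirical pair stays inside the ball where the
  modulus is valid.\<close>

lemma modulus_explored:
  assumes i: "i \<in> {1..K}" and m: "m \<le> n" and explored: "explored f \<delta> x i m"
  shows "m \<ge> 1" "\<bar>f (emp x i m) - f (p i)\<bar> \<le> \<phi> i (conf \<delta> m)"
proof -
  obtain k where k: "k \<in> {1..m}" "ereal (conf \<delta> k) \<le> ereal (1/2) * disc_dist f (emp x i k)"
    using explored unfolding explored_def by blast
  show "m \<ge> 1" using k by simp
  have conf: "0 < conf \<delta> m" "conf \<delta> m \<le> conf \<delta> k"
    using conf_pos conf_antimono k \<delta> by auto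
  have k_close: "l1_dist (p i) (emp x i k) \<le> conf \<delta> k / 2"
    using concentrated[OF i, of k] k m by (simp add: l1_dist_commute)
  have "ereal (2 * conf \<delta> k) \<le> disc_dist f (emp x i k)"
    using k(2) by (cases "disc_dist f (emp x i k)") auto
  also have "\<dots> \<le> disc_dist f (p i) + ereal (l1_dist (p i) (emp x i k))"
    by (rule disc_dist_triangle)
  \<comment> \<open>The inequality yields 3/2 times \<open>conf \<delta> k\<close>; the weaker
    factor 1 is enough here.\<close>
  finally have radius: "ereal (conf \<delta> k) \<le> disc_dist f (p i)"
    using k_close conf by (cases "disc_dist f (p i)") auto
  have close: "emp x i m \<in> D" "l1_dist (emp x i m) (p i) \<le> conf \<delta> m / 2"
    using concentrated[OF i, of m] \<open>m \<ge> 1\<close> m by auto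
  have "ereal (l1_dist (emp x i m) (p i)) \<le> ereal (conf \<delta> k)"
    using close conf by simp
  also note radius
  finally have "emp x i m \<in> l1_ball (p i) (disc_dist f (p i))"
    using close by (simp add: l1_ball_def)
  then have "\<bar>f (emp x i m) - f (p i)\<bar> \<le> \<phi> i (l1_dist (emp x i m) (p i))"
    using i by (intro modulus)
  also have "\<dots> \<le> \<phi> i (conf \<delta> m)"
    using close(2) conf l1_dist_nonneg[of "emp x i m" "p i"]
    by (intro mono_onD[OF strict_mono_on_imp_mono_on[OF strict_mono[OF i]]]) auto
  finally show "\<bar>f (emp x i m) - f (p i)\<bar> \<le> \<phi> i (conf \<delta> m)" .
qed

text \<open>Either the chosen arm is still being explored, or every arm has been explored, including
  \<open>istar\<close>, so that the modulus controls both indices being compared.\<close>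

lemma pull_step:
  assumes t: "t \<in> {1..n}"
  shows "a t \<in> {1..K}" "ereal (real (pulls a (a t) (t - 1))) \<le> pull_bound (a t)"
proof -
  define N where "N i = pulls a i (t - 1)" for i
  have N: "N i \<le> n" for i
    using pulls_le[of a i "t - 1"] t unfolding N_def atLeastAtMost_iff by linarith
  have "a t \<in> {1..K} \<and> ereal (real (N (a t))) \<le> pull_bound (a t)"
  proof (cases "\<exists>i\<in>{1..K}. \<not> explored f \<delta> x i (N i)")
    case True
    then have least: "a t = (LEAST i. i \<in> {1..K} \<and> \<not> explored f \<delta> x i (N i))"
      using step[OF t] unfolding lcb2_step_def N_def by simp
    have "\<exists>i. i \<in> {1..K} \<and> \<not> explored f \<delta> x i (N i)"
      using True by (simp only: Bex_def)
    from LeastI_ex[OF this] have "a t \<in> {1..K} \<and> \<not> explored f \<delta> x (a t) (N (a t))"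
      unfolding least[symmetric] .
    then show ?thesis
      using unexplored_pulls_le[of "a t" "N (a t)"] N[of "a t"] by simp
  next
    case False
    then have arg_min: "is_arg_min (\<lambda>i. f (emp x i (N i)) - \<phi> i (conf \<delta> (N i))) (\<lambda>i. i \<in> {1..K}) (a t)"
      using step[OF t] unfolding lcb2_step_def N_def by simp
    then have i: "a t \<in> {1..K}" by (simp add: is_arg_min_def)
    have star: "istar \<in> {1..K}" using istar by (simp add: is_arg_min_def)
    note chosen = modulus_explored[OF i N] and best = modulus_explored[OF star N]
    have ex: "explored f \<delta> x (a t) (N (a t))" "explored f \<delta> x istar (N istar)"
      using False i star by auto
    have "f (emp x (a t) (N (a t))) - \<phi> (a t) (conf \<delta> (N (a t)))
        \<le> f (emp x istar (N istar)) - \<phi> istar (conf \<delta> (N istar))"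
      using arg_min star by (auto simp: is_arg_min_linorder)
    \<comment> \<open>The lower confidence bound of \<open>istar\<close> is at most its true value,
      so the modulus of \<open>istar\<close> cancels. That of the chosen arm enters twice, once
      through the index and once through the estimation error, hence the division by 2.\<close>
    then have "(f (p (a t)) - f (p istar)) / 2 \<le> \<phi> (a t) (conf \<delta> (N (a t)))"
      using chosen(2)[OF ex(1)] best(2)[OF ex(2)] by (simp add: abs_le_iff)
    then have le: "gen_inv (\<phi> (a t)) ((f (p (a t)) - f (p istar)) / 2) \<le> ereal (conf \<delta> (N (a t)))"
      using conf_pos[OF chosen(1)[OF ex(1)] \<delta>] by (intro gen_inv_le) auto
    have "ereal (real (N (a t))) \<le>
        ereal 18 / (gen_inv (\<phi> (a t)) ((f (p (a t)) - f (p istar)) / 2))\<^sup>2 * ereal (ln (1 / \<delta>))"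
      using gen_inv_nonneg le ln_pos
      by (rule le_ereal_const_div_square_mult) (use conf_square[OF chosen(1)[OF ex(1)] \<delta>] in auto)
    also have "\<dots> \<le> pull_bound (a t)"
      using exploitation_le_pull_bound[of "a t"] by simp
    finally show ?thesis using i by simp
  qed
  then show "a t \<in> {1..K}" "ereal (real (pulls a (a t) (t - 1))) \<le> pull_bound (a t)"
    by (simp_all add: N_def)
qed

text \<open>A count grows only when its own arm is pulled, and just before each such pull it is at
  most \<open>pull_bound i\<close>. Induction over time thus loses a single pull.\<close>

lemma pulls_le_pull_bound: "t \<le> n \<Longrightarrow> ereal (real (pulls a i t)) \<le> pull_bound i + 1"
proof (induction t)
  case 0
  then show ?case
    using pull_bound_nonneg[of i] by (simp add: pulls_def zero_ereal_def[symmetric])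
next
  case (Suc t)
  show ?case
  proof (cases "a (Suc t) = i")
    case True
    then have "ereal (real (pulls a i t)) \<le> pull_bound i"
      using pull_step(2)[of "Suc t"] Suc.prems by auto
    then have "ereal (real (pulls a i t)) + 1 \<le> pull_bound i + 1"
      by (rule add_right_mono)
    then show ?thesis using True by (simp add: pulls_Suc one_ereal_def add.commute)
  next
    case False
    then show ?thesis using Suc by (simp add: pulls_Suc)
  qed
qed

lemma regret_le:
  fixes v \<Delta> :: "nat \<Rightarrow> real"
  assumes v: "\<And>i. v i = f (p i)" and \<Delta>: "\<And>i. \<Delta> i = v i - v istar"
  shows "ereal (regret v istar n a)
    \<le> (\<Sum>i \<in> {i \<in> {1..K}. \<Delta> i > 0}.
         ereal (\<Delta> i) * (162 * (1 / (disc_dist f (p i))\<^sup>2) + 18 / (gen_inv (\<phi> i) (\<Delta> i / 2))\<^sup>2)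
           * ereal (ln (1 / \<delta>)))
      + ereal (\<Sum>i \<in> {i \<in> {1..K}. \<Delta> i > 0}. \<Delta> i)"
proof -
  let ?P = "{i \<in> {1..K}. \<Delta> i > 0}"
  have \<Delta>_nonneg: "0 \<le> \<Delta> i" if "i \<in> {1..K}" for i
    using istar that by (auto simp: is_arg_min_linorder \<Delta> v)
  have "regret v istar n a = (\<Sum>i=1..K. \<Delta> i * real (pulls a i n))"
    unfolding \<Delta> using pull_step(1) by (rule regret_eq_sum_pulls)
  \<comment> \<open>Gaps are nonnegative by minimality of \<open>istar\<close>, so only zero terms
    are dropped.\<close>
  also have "\<dots> = (\<Sum>i\<in>?P. \<Delta> i * real (pulls a i n))"
    using \<Delta>_nonneg by (intro sum.mono_neutral_right) (auto simp: order_less_le)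
  finally have "ereal (regret v istar n a) = (\<Sum>i\<in>?P. ereal (\<Delta> i) * ereal (real (pulls a i n)))"
    by (simp add: sum_ereal[symmetric] del: sum_ereal)
  also have "\<dots> \<le> (\<Sum>i\<in>?P. ereal (\<Delta> i) * pull_bound i + ereal (\<Delta> i))"
  proof (rule sum_mono)
    fix i assume i: "i \<in> ?P"
    have "ereal (\<Delta> i) * ereal (real (pulls a i n)) \<le> ereal (\<Delta> i) * (pull_bound i + 1)"
      using i by (intro ereal_mult_left_mono pulls_le_pull_bound) auto
    \<comment> \<open>Distributivity over extended reals relies on both summands being nonnegative;
      \<open>pull_bound i\<close> may be infinite.\<close>
    also have "\<dots> = ereal (\<Delta> i) * pull_bound i + ereal (\<Delta> i)"
      by (simp add: ereal_right_distrib pull_bound_nonneg)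
    finally show "ereal (\<Delta> i) * ereal (real (pulls a i n)) \<le> ereal (\<Delta> i) * pull_bound i + ereal (\<Delta> i)" .
  qed
  also have "\<dots> = (\<Sum>i\<in>?P. ereal (\<Delta> i) * pull_bound i) + ereal (\<Sum>i\<in>?P. \<Delta> i)"
    by (simp add: sum.distrib)
  finally show ?thesis
    by (simp add: pull_bound_def \<Delta> v mult.assoc)
qed

end

section \<open>Concentration of the empirical mean and variance\<close>

lemma emp_mean_in_unit:
  assumes "t \<ge> 1" "\<And>s. s \<in> {1..t} \<Longrightarrow> x i s \<in> {0..1}"
  shows "emp_mean x i t \<in> {0..1}"
proof -
  have "0 \<le> (\<Sum>s=1..t. x i s)"
    using assms by (intro sum_nonneg) auto
  moreover have "(\<Sum>s=1..t. x i s) \<le> real (card {1..t}) * 1"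
    using assms by (intro sum_bounded_above) auto
  ultimately show ?thesis
    using assms(1) by (simp add: emp_mean_def)
qed

lemma square_diff_in_unit: "y \<in> {0..1} \<Longrightarrow> z \<in> {0..1} \<Longrightarrow> (y - z)\<^sup>2 \<in> {0..1::real}"
  using abs_square_le_1[of "y - z"] by (simp add: abs_le_iff)

lemma emp_in_D:
  assumes "t \<ge> 1" "\<And>s. s \<in> {1..t} \<Longrightarrow> x i s \<in> {0..1}"
  shows "emp x i t \<in> D"
proof -
  have mean: "emp_mean x i t \<in> {0..1}"
    using assms by (rule emp_mean_in_unit)
  have "(\<Sum>s=1..t. (x i s - emp_mean x i t)\<^sup>2) \<le> real (card {1..t}) * 1"
  proof (rule sum_bounded_above)
    fix s assume "s \<in> {1..t}"
    then show "(x i s - emp_mean x i t)\<^sup>2 \<le> 1"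
      using square_diff_in_unit[OF assms(2) mean, of s] by simp
  qed
  then have "emp_var x i t \<in> {0..1}"
    using assms(1) by (simp add: emp_var_def sum_nonneg)
  with mean show ?thesis
    by (simp add: emp_def D_def)
qed

text \<open>Recentring at a fixed \<open>\<mu>\<close> replaces the dependent deviations from the
  empirical mean by independent summands, to which Hoeffding's inequality applies, at the price of a
  squared error of the mean.\<close>

lemma emp_var_eq:
  assumes "t \<ge> 1"
  shows "emp_var x i t = (\<Sum>s=1..t. (x i s - \<mu>)\<^sup>2) / real t - (emp_mean x i t - \<mu>)\<^sup>2"
proof -
  define m where "m = emp_mean x i t"
  have sum_eq: "(\<Sum>s=1..t. x i s) = real t * m"
    using assms by (simp add: m_def emp_mean_def)
  have "(\<Sum>s=1..t. (x i s - m)\<^sup>2) - (\<Sum>s=1..t. (x i s - \<mu>)\<^sup>2)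
      = (\<Sum>s=1..t. 2 * (\<mu> - m) * x i s + (m\<^sup>2 - \<mu>\<^sup>2))"
    unfolding sum_subtractf[symmetric]
    by (rule sum.cong) (auto simp: power2_eq_square algebra_simps)
  also have "\<dots> = 2 * (\<mu> - m) * (real t * m) + real t * (m\<^sup>2 - \<mu>\<^sup>2)"
    unfolding sum.distrib sum_distrib_left[symmetric] sum_eq by simp
  also have "\<dots> = - real t * (m - \<mu>)\<^sup>2"
    by (simp add: power2_eq_square algebra_simps)
  finally have "(\<Sum>s=1..t. (x i s - m)\<^sup>2) = (\<Sum>s=1..t. (x i s - \<mu>)\<^sup>2) - real t * (m - \<mu>)\<^sup>2"
    by simp
  then show ?thesis
    using assms by (simp add: emp_var_def m_def[symmetric] diff_divide_distrib)
qed

text \<open>The factor 3 collects the error of the mean, the error of the recentred second moment,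
  and the squared error of the mean. It is applied with \<open>c = conf \<delta> m / 6\<close>,
  giving \<open>conf \<delta> m / 2\<close>.\<close>

lemma emp_close:
  assumes t: "t \<ge> 1" and x: "\<And>s. s \<in> {1..t} \<Longrightarrow> x i s \<in> {0..1}" and \<mu>: "\<mu> \<in> {0..1}"
    and mean: "\<bar>(\<Sum>s=1..t. x i s) - real t * \<mu>\<bar> \<le> real t * c"
    and var: "\<bar>(\<Sum>s=1..t. (x i s - \<mu>)\<^sup>2) - real t * \<sigma>\<bar> \<le> real t * c"
  shows "l1_dist (emp x i t) (\<mu>, \<sigma>) \<le> 3 * c"
proof -
  define d where "d = emp_mean x i t - \<mu>"
  have d: "\<bar>d\<bar> \<le> c"
    using mean t unfolding d_def emp_mean_def by (simp add: abs_le_iff field_simps)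
  have var': "\<bar>(\<Sum>s=1..t. (x i s - \<mu>)\<^sup>2) / real t - \<sigma>\<bar> \<le> c"
    using var t by (simp add: abs_le_iff field_simps)
  \<comment> \<open>Both means lie in the unit interval, so squaring the error does not increase
    it.\<close>
  have "\<bar>d\<bar> \<le> 1"
    using emp_mean_in_unit[of t x i, OF t x] \<mu> by (auto simp: d_def abs_le_iff)
  then have "\<bar>d\<bar> * \<bar>d\<bar> \<le> \<bar>d\<bar> * 1"
    by (intro mult_left_mono) auto
  then have "d\<^sup>2 \<le> c"
    using d by (simp add: power2_eq_square)
  then have "\<bar>emp_var x i t - \<sigma>\<bar> \<le> 2 * c"
    using var' zero_le_power2[of d] unfolding emp_var_eq[OF t, of x i \<mu>] d_def[symmetric]
    by linarith
  with d show ?thesis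
    by (simp add: l1_dist_def emp_def d_def)
qed

section \<open>Hoeffding's inequality and the union bound\<close>

lemma (in prob_space) integral_in_unit:
  fixes h :: "'a \<Rightarrow> real"
  assumes [measurable]: "h \<in> borel_measurable M" and ae: "AE x in M. h x \<in> {0..1}"
  shows "(\<integral>x. h x \<partial>M) \<in> {0..1}"
proof -
  have "integrable M h"
    by (rule integrable_const_bound[where B = 1]) (use ae in auto)
  then show ?thesis
    using ae integral_ge_const[of h 0] integral_le_const[of h 1] by auto
qed

lemma mean_var_in_D:
  assumes "prob_space \<nu>" "sets \<nu> = sets borel" "AE y in \<nu>. y \<in> {0..1::real}"
  shows "mean_var \<nu> \<in> D"
proof -
  interpret prob_space \<nu> by fact
  note [measurable_cong] = assms(2)
  have mean: "(\<integral>y. y \<partial>\<nu>) \<in> {0..1}"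
    using assms(3) by (intro integral_in_unit) auto
  have "AE y in \<nu>. (y - (\<integral>z. z \<partial>\<nu>))\<^sup>2 \<in> {0..1}"
    using assms(3) by eventually_elim (rule square_diff_in_unit[OF _ mean])
  then have "(\<integral>y. (y - (\<integral>z. z \<partial>\<nu>))\<^sup>2 \<partial>\<nu>) \<in> {0..1}"
    by (intro integral_in_unit) auto
  with mean show ?thesis
    by (simp add: mean_var_def D_def)
qed

text \<open>One statement serves the mean, with \<open>h\<close> the identity, and the variance,
  with \<open>h\<close> the squared deviation from the true mean. Applying \<open>h\<close> termwise
  preserves independence. The threshold is chosen so that the exponent becomes
  \<open>ln \<delta>\<close>; the factor 2 counts both tails.\<close>

lemma (in prob_space) hoeffding_transformed_sample:
  fixes Y :: "nat \<Rightarrow> 'a \<Rightarrow> real" and h :: "real \<Rightarrow> real"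
  assumes indep: "indep_vars (\<lambda>_. borel) Y {1..}"
    and distr: "\<And>s. s \<ge> 1 \<Longrightarrow> distr M borel (Y s) = \<nu>"
    and h [measurable]: "h \<in> borel_measurable borel"
    and ae: "AE y in \<nu>. h y \<in> {0..1}"
    and t: "t \<ge> 1" and \<delta>: "0 < \<delta>" "\<delta> < 1"
  shows "prob {\<omega> \<in> space M. real t * (conf \<delta> t / 6) \<le>
            \<bar>(\<Sum>s=1..t. h (Y s \<omega>)) - real t * (\<integral>y. h y \<partial>\<nu>)\<bar>} \<le> 2 * \<delta>"
proof -
  have Y [measurable]: "random_variable borel (Y s)" if "s \<ge> 1" for s
    using indep that by (auto simp: indep_vars_def)
  have ae': "AE \<omega> in M. h (Y s \<omega>) \<in> {0..1}" if s: "s \<ge> 1" for s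
  proof -
    have "AE y in distr M borel (Y s). h y \<in> {0..1}"
      unfolding distr[OF s] by (rule ae)
    then show ?thesis
      using Y[OF s] by (subst (asm) AE_distr_iff) auto
  qed
  have expectation_h: "expectation (\<lambda>\<omega>. h (Y s \<omega>)) = (\<integral>y. h y \<partial>\<nu>)" if s: "s \<ge> 1" for s
    unfolding distr[OF s, symmetric] using Y[OF s] by (intro integral_distr[symmetric]) auto
  have "indep_vars (\<lambda>_. borel) (\<lambda>s \<omega>. h (Y s \<omega>)) {1..t}"
    by (rule indep_vars_compose2[OF indep_vars_subset[OF indep]]) auto
  then interpret Hoeffding_ineq M "{1..t}" "\<lambda>s \<omega>. h (Y s \<omega>)" "\<lambda>_. 0" "\<lambda>_. 1"
    "\<Sum>s=1..t. expectation (\<lambda>\<omega>. h (Y s \<omega>))"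
    by unfold_locales (use ae' in auto)
  define c where "c = real t * (conf \<delta> t / 6)"
  have "0 \<le> c"
    using conf_pos[OF t \<delta>] by (simp add: c_def)
  then have "prob {\<omega> \<in> space M. c \<le> \<bar>(\<Sum>s=1..t. h (Y s \<omega>))
        - (\<Sum>s=1..t. expectation (\<lambda>\<omega>. h (Y s \<omega>)))\<bar>} \<le> 2 * exp (- 2 * c\<^sup>2 / real t)"
    using Hoeffding_ineq_abs_ge[of c] t by simp
  also have "(\<Sum>s=1..t. expectation (\<lambda>\<omega>. h (Y s \<omega>))) = real t * (\<integral>y. h y \<partial>\<nu>)"
    by (simp add: expectation_h)
  also have "- 2 * c\<^sup>2 / real t = - (real t * (conf \<delta> t)\<^sup>2 / 18)"
    using t by (simp add: c_def power2_eq_square)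
  also have "\<dots> = ln \<delta>"
    using conf_square[OF t \<delta>] \<delta> by (simp add: ln_div)
  also have "exp (ln \<delta>) = \<delta>"
    using \<delta> by simp
  finally show ?thesis by (simp add: c_def)
qed

text \<open>All pull counts up to \<open>n\<close> are covered simultaneously, so the estimates
  remain valid at the random counts produced by the adaptive algorithm. Each pair of arm and count
  costs \<open>2 * \<delta>\<close> for the mean and \<open>2 * \<delta>\<close> for the
  variance.\<close>

lemma concentration_event:
  fixes M :: "'w measure" and X :: "nat \<Rightarrow> nat \<Rightarrow> 'w \<Rightarrow> real"
  assumes M: "prob_space M"
    and \<nu>: "\<And>i. i \<in> {1..K} \<Longrightarrow> prob_space (\<nu> i)"
      "\<And>i. i \<in> {1..K} \<Longrightarrow> sets (\<nu> i) = sets borel"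
      "\<And>i. i \<in> {1..K} \<Longrightarrow> AE y in \<nu> i. y \<in> {0..1}"
    and indep: "\<And>i. i \<in> {1..K} \<Longrightarrow> prob_space.indep_vars M (\<lambda>_. borel) (X i) {1..}"
    and distr: "\<And>i s. i \<in> {1..K} \<Longrightarrow> s \<ge> 1 \<Longrightarrow> distr M borel (X i s) = \<nu> i"
    and \<delta>: "0 < \<delta>" "\<delta> < 1"
  shows "\<exists>E \<in> sets M. 1 - 4 * real K * real n * \<delta> \<le> measure M E \<and>
    (\<forall>\<omega> \<in> E. \<forall>i \<in> {1..K}. \<forall>m \<in> {1..n}. emp (\<lambda>i s. X i s \<omega>) i m \<in> D \<and>
       l1_dist (emp (\<lambda>i s. X i s \<omega>) i m) (mean_var (\<nu> i)) \<le> conf \<delta> m / 2)"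
proof -
  interpret prob_space M by fact
  have X [measurable]: "X i s \<in> borel_measurable M" if "i \<in> {1..K}" "s \<ge> 1" for i s
    using indep[OF that(1)] that(2) by (auto simp: indep_vars_def)
  define \<mu> \<sigma> where "\<mu> i = fst (mean_var (\<nu> i))" and "\<sigma> i = snd (mean_var (\<nu> i))" for i
  define U where "U i t = {\<omega> \<in> space M. real t * (conf \<delta> t / 6) \<le>
    \<bar>(\<Sum>s=1..t. X i s \<omega>) - real t * \<mu> i\<bar>}" for i t
  define V where "V i t = {\<omega> \<in> space M. real t * (conf \<delta> t / 6) \<le>
    \<bar>(\<Sum>s=1..t. (X i s \<omega> - \<mu> i)\<^sup>2) - real t * \<sigma> i\<bar>}" for i t
  \<comment> \<open>Rewards lie in the unit interval only almost surely; these null sets are removed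
    to make the pathwise bounds applicable.\<close>
  define W where "W i t = {\<omega> \<in> space M. X i t \<omega> \<notin> {0..1}}" for i t
  define I where "I = {1..K} \<times> {1..n}"
  define B where "B = (\<Union>(i, t)\<in>I. U i t \<union> V i t \<union> W i t)"
  have \<mu>: "\<mu> i \<in> {0..1}" if "i \<in> {1..K}" for i
    using mean_var_in_D[OF \<nu>[OF that]] by (auto simp: \<mu>_def D_def)
  have sets_U: "U i t \<in> sets M" and sets_V: "V i t \<in> sets M" if "i \<in> {1..K}" for i t
    unfolding U_def V_def using that by measurable
  have sets_W: "W i t \<in> sets M" if "i \<in> {1..K}" "t \<ge> 1" for i t
    using X[OF that] unfolding W_def by measurable
  have U: "prob (U i t) \<le> 2 * \<delta>" if "i \<in> {1..K}" "t \<ge> 1" for i t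
    using hoeffding_transformed_sample[where h = "\<lambda>y. y", OF indep[OF that(1)] distr[OF that(1)] _ \<nu>(3)[OF that(1)]
      that(2) \<delta>]
    by (simp add: U_def \<mu>_def mean_var_def)
  have V: "prob (V i t) \<le> 2 * \<delta>" if "i \<in> {1..K}" "t \<ge> 1" for i t
  proof -
    have "AE y in \<nu> i. (y - \<mu> i)\<^sup>2 \<in> {0..1}"
      using \<nu>(3)[OF that(1)] by eventually_elim (rule square_diff_in_unit[OF _ \<mu>[OF that(1)]])
    then show ?thesis
      using hoeffding_transformed_sample[where h = "\<lambda>y. (y - \<mu> i)\<^sup>2", OF indep[OF that(1)] distr[OF that(1)]
        _ _ that(2) \<delta>]
      by (simp add: V_def \<mu>_def \<sigma>_def mean_var_def)
  qed
  have W: "prob (W i t) = 0" if "i \<in> {1..K}" "t \<ge> 1" for i t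
  proof -
    have "AE y in distr M borel (X i t). y \<in> {0..1}"
      unfolding distr[OF that] by (rule \<nu>(3)[OF that(1)])
    then have "AE \<omega> in M. X i t \<omega> \<in> {0..1}"
      using X[OF that] by (subst (asm) AE_distr_iff) auto
    then have "AE \<omega> in M. \<omega> \<notin> W i t"
      by eventually_elim (simp add: W_def)
    then show ?thesis
      using sets_W[OF that] by (simp add: prob_eq_0)
  qed
  have bad: "prob (U i t \<union> V i t \<union> W i t) \<le> 4 * \<delta>" if "i \<in> {1..K}" "t \<ge> 1" for i t
    using measure_Un_le[of "U i t" M "V i t"] measure_Un_le[of "U i t \<union> V i t" M "W i t"]
      U[OF that] V[OF that] W[OF that] sets_U[OF that(1)] sets_V[OF that(1)] sets_W[OF that] by auto
  have sets_B: "B \<in> sets M"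
    unfolding B_def I_def using sets_U sets_V sets_W by (intro sets.finite_UN) auto
  have "prob B \<le> (\<Sum>(i, t)\<in>I. prob (U i t \<union> V i t \<union> W i t))"
    unfolding B_def case_prod_unfold
    by (rule measure_UNION_le) (use sets_U sets_V sets_W in \<open>auto simp: I_def\<close>)
  also have "\<dots> \<le> real (card I) * (4 * \<delta>)"
    by (rule sum_bounded_above) (auto simp: I_def intro!: bad)
  also have "\<dots> = 4 * real K * real n * \<delta>"
    by (simp add: I_def card_cartesian_product)
  finally have prob: "1 - 4 * real K * real n * \<delta> \<le> prob (space M - B)"
    using prob_compl[OF sets_B] by simp
  have "emp (\<lambda>i s. X i s \<omega>) i m \<in> D \<and>
       l1_dist (emp (\<lambda>i s. X i s \<omega>) i m) (mean_var (\<nu> i)) \<le> conf \<delta> m / 2"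
    if \<omega>: "\<omega> \<in> space M - B" and i: "i \<in> {1..K}" and m: "m \<in> {1..n}" for \<omega> i m
  proof -
    have good: "\<omega> \<notin> U i t" "\<omega> \<notin> V i t" "\<omega> \<notin> W i t" if "t \<in> {1..n}" for t
      using \<omega> i that by (auto simp: B_def I_def)
    have x: "X i s \<omega> \<in> {0..1}" if "s \<in> {1..m}" for s
      using good(3)[of s] \<omega> that m by (simp add: W_def)
    have "l1_dist (emp (\<lambda>i s. X i s \<omega>) i m) (\<mu> i, \<sigma> i) \<le> 3 * (conf \<delta> m / 6)"
      using m x \<mu>[OF i] good(1,2)[OF m] \<omega> by (intro emp_close) (auto simp: U_def V_def)
    then show ?thesis
      using m x emp_in_D[of m "\<lambda>i s. X i s \<omega>" i] by (simp add: \<mu>_def \<sigma>_def)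
  qed
  with prob sets_B show ?thesis
    by (intro bexI[of _ "space M - B"]) auto
qed

section \<open>From the concentration event to the regret bounds\<close>

theorem theorem2:
  fixes M :: "'w measure"
    and K :: nat
    and \<nu> :: "nat \<Rightarrow> real measure"
    and X :: "nat \<Rightarrow> nat \<Rightarrow> 'w \<Rightarrow> real"
    and f :: "real \<times> real \<Rightarrow> real"
    and \<phi> :: "nat \<Rightarrow> real \<Rightarrow> real"
    and e :: "nat \<Rightarrow> ereal"
    and v \<Delta> :: "nat \<Rightarrow> real"
    and istar :: nat
  assumes "K \<ge> 1"
    and "\<And>i. i \<in> {1..K} \<Longrightarrow> prob_space (\<nu> i)"
    and "\<And>i. i \<in> {1..K} \<Longrightarrow> sets (\<nu> i) = sets borel"
    and "\<And>i. i \<in> {1..K} \<Longrightarrow> measure (\<nu> i) {0..1} = 1"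
    and "prob_space M"
    and "\<And>i. i \<in> {1..K} \<Longrightarrow> prob_space.indep_vars M (\<lambda>_. borel) (X i) {1..}"
    and "\<And>i s. i \<in> {1..K} \<Longrightarrow> s \<ge> 1 \<Longrightarrow> distr M borel (X i s) = \<nu> i"
    and "\<And>i. i \<in> {1..K} \<Longrightarrow>
           \<exists>\<epsilon>>0. continuous_on (l1_ball (mean_var (\<nu> i)) (ereal \<epsilon>)) f"
    and "\<And>i. e i = cont_radius f (mean_var (\<nu> i))"
    and "\<And>i. i \<in> {1..K} \<Longrightarrow> \<phi> i \<in> {0..} \<rightarrow> {0..}"
    and "\<And>i. i \<in> {1..K} \<Longrightarrow> strict_mono_on {0..} (\<phi> i)"
    and "\<And>i. i \<in> {1..K} \<Longrightarrow> \<phi> i 0 = 0"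
    and "\<And>i p q. i \<in> {1..K} \<Longrightarrow>
           p \<in> l1_ball (mean_var (\<nu> i)) (e i) \<Longrightarrow> q \<in> l1_ball (mean_var (\<nu> i)) (e i) \<Longrightarrow>
           \<bar>f q - f p\<bar> \<le> \<phi> i (l1_dist q p)"
    and "\<And>i. v i = f (mean_var (\<nu> i))"
    and "is_arg_min v (\<lambda>i. i \<in> {1..K}) istar"
    and "\<And>i. \<Delta> i = v i - v istar"
  shows "(\<forall>i \<in> {1..K}. e i = disc_dist f (mean_var (\<nu> i))) \<and>
    (\<forall>(n::nat) (\<delta>::real) A.
       n \<ge> 1 \<longrightarrow> 0 < \<delta> \<longrightarrow> \<delta> < 1 / (4 * real K * real n) \<longrightarrow>
       (\<Sum>i=1..K. 162 * (1 / (e i)\<^sup>2) * ereal (ln (1 / \<delta>))) \<le> ereal (real n) \<longrightarrow>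
       lcb2_run M K f \<phi> \<delta> X n A \<longrightarrow>
       holds_with_prob M (1 - 4 * real K * real n * \<delta>) (\<lambda>\<omega>.
         ereal (regret v istar n (\<lambda>t. A t \<omega>))
           \<le> (\<Sum>i \<in> {i \<in> {1..K}. \<Delta> i > 0}.
                ereal (\<Delta> i) * (162 * (1 / (e i)\<^sup>2) + 18 / (gen_inv (\<phi> i) (\<Delta> i / 2))\<^sup>2)
                  * ereal (ln (1 / \<delta>)))
             + ereal (\<Sum>i \<in> {i \<in> {1..K}. \<Delta> i > 0}. \<Delta> i))) \<and>
    (\<forall>(n::nat) A.
       n \<ge> 1 \<longrightarrow>
       (\<Sum>i=1..K. 324 * (1 / (e i)\<^sup>2) * ereal (ln (real n))) \<le> ereal (real n) \<longrightarrow>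
       lcb2_run M K f \<phi> (1 / (real n)\<^sup>2) X n A \<longrightarrow>
       holds_with_prob M (1 - 4 * real K / real n) (\<lambda>\<omega>.
         ereal (regret v istar n (\<lambda>t. A t \<omega>))
           \<le> (\<Sum>i \<in> {i \<in> {1..K}. \<Delta> i > 0}.
                ereal (\<Delta> i) * (324 * (1 / (e i)\<^sup>2) + 36 / (gen_inv (\<phi> i) (\<Delta> i / 2))\<^sup>2)
                  * ereal (ln (real n)))
             + ereal (\<Sum>i \<in> {i \<in> {1..K}. \<Delta> i > 0}. \<Delta> i)))"
proof -
  note e = assms(9) and v = assms(14) and istar = assms(15) and \<Delta> = assms(16)
  have supp: "AE y in \<nu> i. y \<in> {0..1}" if "i \<in> {1..K}" for i
    using assms(2-4)[OF that] by (subst prob_space.AE_in_set_eq_1) auto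
  have e_eq: "e i = disc_dist f (mean_var (\<nu> i))" if "i \<in> {1..K}" for i
    using assms(8)[OF that] cont_radius_eq_disc_dist e by metis
  have e_pos: "0 < e i" if i: "i \<in> {1..K}" for i
  proof -
    obtain \<epsilon> where \<epsilon>: "\<epsilon> > 0" "continuous_on (l1_ball (mean_var (\<nu> i)) (ereal \<epsilon>)) f"
      using assms(8)[OF i] by blast
    have "0 < ereal \<epsilon>" using \<epsilon>(1) by simp
    also have "\<dots> \<le> e i"
      unfolding e_eq[OF i] using \<epsilon>(2) by (rule disc_dist_ge_radius)
    finally show ?thesis .
  qed
  have in_D: "mean_var (\<nu> i) \<in> D" if "i \<in> {1..K}" for i
    using assms(2,3)[OF that] supp[OF that] by (rule mean_var_in_D)
  \<comment> \<open>Both regret bounds are derived from this single statement for any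
    \<open>\<delta>\<close> strictly between 0 and 1.\<close>
  have run: "holds_with_prob M (1 - 4 * real K * real n * \<delta>) (\<lambda>\<omega>.
      ereal (regret v istar n (\<lambda>t. A t \<omega>))
        \<le> (\<Sum>i \<in> {i \<in> {1..K}. \<Delta> i > 0}.
             ereal (\<Delta> i) * (162 * (1 / (e i)\<^sup>2) + 18 / (gen_inv (\<phi> i) (\<Delta> i / 2))\<^sup>2)
               * ereal (ln (1 / \<delta>)))
          + ereal (\<Sum>i \<in> {i \<in> {1..K}. \<Delta> i > 0}. \<Delta> i))"
    if \<delta>: "0 < \<delta>" "\<delta> < 1" and A: "lcb2_run M K f \<phi> \<delta> X n A" for n \<delta> A
  proof -
    have "\<exists>E \<in> sets M. 1 - 4 * real K * real n * \<delta> \<le> measure M E \<and>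
      (\<forall>\<omega> \<in> E. \<forall>i \<in> {1..K}. \<forall>m \<in> {1..n}. emp (\<lambda>i s. X i s \<omega>) i m \<in> D \<and>
         l1_dist (emp (\<lambda>i s. X i s \<omega>) i m) (mean_var (\<nu> i)) \<le> conf \<delta> m / 2)"
      by (rule concentration_event; fact assms supp \<delta>)
    then obtain E where E: "E \<in> sets M" "1 - 4 * real K * real n * \<delta> \<le> measure M E"
      and concentrated: "\<And>\<omega> i m. \<omega> \<in> E \<Longrightarrow> i \<in> {1..K} \<Longrightarrow> m \<in> {1..n} \<Longrightarrow>
        emp (\<lambda>i s. X i s \<omega>) i m \<in> D \<and>
        l1_dist (emp (\<lambda>i s. X i s \<omega>) i m) (mean_var (\<nu> i)) \<le> conf \<delta> m / 2"
      by (elim bexE conjE) simp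
    show ?thesis
      unfolding holds_with_prob_def
    proof (intro bexI[of _ E] conjI ballI)
      fix \<omega> assume \<omega>: "\<omega> \<in> E"
      have "\<omega> \<in> space M"
        using sets.sets_into_space[OF E(1)] \<omega> by (rule subsetD)
      interpret concentrated_lcb2 K f \<phi> "\<lambda>i. mean_var (\<nu> i)" \<delta> n "\<lambda>i s. X i s \<omega>" "\<lambda>t. A t \<omega>" istar
      proof
        fix i q assume i: "i \<in> {1..K}" and q: "q \<in> l1_ball (mean_var (\<nu> i)) (disc_dist f (mean_var (\<nu> i)))"
        \<comment> \<open>The centre lies in its own ball because \<open>e i\<close> is positive, so
          the modulus hypothesis may be used with the centre as one of its two points.\<close>
        have "mean_var (\<nu> i) \<in> l1_ball (mean_var (\<nu> i)) (e i)"
          using in_D[OF i] e_pos[OF i] by (simp add: l1_ball_def zero_ereal_def[symmetric])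
        then show "\<bar>f q - f (mean_var (\<nu> i))\<bar> \<le> \<phi> i (l1_dist q (mean_var (\<nu> i)))"
          using assms(13)[OF i] q e_eq[OF i] by simp
      next
        show "is_arg_min (\<lambda>i. f (mean_var (\<nu> i))) (\<lambda>i. i \<in> {1..K}) istar"
          using istar unfolding v[abs_def] .
      qed (use \<delta> in_D e_pos e_eq assms(11) concentrated[OF \<omega>] A \<open>\<omega> \<in> space M\<close>
          in \<open>auto simp: lcb2_run_def\<close>)
      show "ereal (regret v istar n (\<lambda>t. A t \<omega>))
        \<le> (\<Sum>i \<in> {i \<in> {1..K}. \<Delta> i > 0}.
             ereal (\<Delta> i) * (162 * (1 / (e i)\<^sup>2) + 18 / (gen_inv (\<phi> i) (\<Delta> i / 2))\<^sup>2)
               * ereal (ln (1 / \<delta>)))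
          + ereal (\<Sum>i \<in> {i \<in> {1..K}. \<Delta> i > 0}. \<Delta> i)"
        using regret_le[of v \<Delta>, OF v \<Delta>] by (simp add: e_eq cong: conj_cong)
    qed (use E in auto)
  qed
  show ?thesis
  proof (intro conjI allI ballI impI)
    fix i assume "i \<in> {1..K}"
    then show "e i = disc_dist f (mean_var (\<nu> i))" by (rule e_eq)
  next
    fix n :: nat and \<delta> :: real and A
    assume n: "n \<ge> 1" and \<delta>: "0 < \<delta>" "\<delta> < 1 / (4 * real K * real n)"
      and A: "lcb2_run M K f \<phi> \<delta> X n A"
    have "1 * 1 \<le> (4 * real K) * real n"
      using n \<open>K \<ge> 1\<close> by (intro mult_mono) auto
    then have "1 / (4 * real K * real n) \<le> 1" by simp
    with \<delta> have "\<delta> < 1" by linarith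
    then show "holds_with_prob M (1 - 4 * real K * real n * \<delta>) (\<lambda>\<omega>.
      ereal (regret v istar n (\<lambda>t. A t \<omega>))
        \<le> (\<Sum>i \<in> {i \<in> {1..K}. \<Delta> i > 0}.
             ereal (\<Delta> i) * (162 * (1 / (e i)\<^sup>2) + 18 / (gen_inv (\<phi> i) (\<Delta> i / 2))\<^sup>2)
               * ereal (ln (1 / \<delta>)))
          + ereal (\<Sum>i \<in> {i \<in> {1..K}. \<Delta> i > 0}. \<Delta> i))"
      using run \<delta>(1) A by blast
  next
    fix n :: nat and A
    assume n: "n \<ge> 1" and A: "lcb2_run M K f \<phi> (1 / (real n)\<^sup>2) X n A"
    let ?P = "\<lambda>\<omega>. ereal (regret v istar n (\<lambda>t. A t \<omega>))
        \<le> (\<Sum>i \<in> {i \<in> {1..K}. \<Delta> i > 0}.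
             ereal (\<Delta> i) * (324 * (1 / (e i)\<^sup>2) + 36 / (gen_inv (\<phi> i) (\<Delta> i / 2))\<^sup>2)
               * ereal (ln (real n)))
          + ereal (\<Sum>i \<in> {i \<in> {1..K}. \<Delta> i > 0}. \<Delta> i)"
    show "holds_with_prob M (1 - 4 * real K / real n) ?P"
    proof (cases "n = 1")
      case True
      \<comment> \<open>Here \<open>\<delta>\<close> would be 1, outside the range of
        \<open>run\<close>. The required probability \<open>1 - 4 * K\<close> is negative, so the
        empty event is a witness.\<close>
      then show ?thesis
        unfolding holds_with_prob_def using \<open>K \<ge> 1\<close> by (intro bexI[of _ "{}"]) auto
    next
      case False
      with n have n: "n > 1" by simp
      have prob: "4 * real K * real n * (1 / (real n)\<^sup>2) = 4 * real K / real n"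
        using n by (simp add: power2_eq_square)
      have ln: "ln (1 / (1 / (real n)\<^sup>2)) = 2 * ln (real n)"
        using n by (simp add: ln_realpow)
      \<comment> \<open>The 2 from \<open>ln (n^2) = 2 * ln n\<close> doubles both constants.
        Nonnegativity allows it to be distributed over the extended-real sum, also for infinite
        \<open>a\<close> or \<open>b\<close> and for \<open>b = 0\<close>.\<close>
      have "(162 * a + 18 / b) * ereal (2 * ln (real n)) = (324 * a + 36 / b) * ereal (ln (real n))"
        if "0 \<le> a" "0 \<le> b" for a b :: ereal
      proof -
        have "ereal (2 * ln (real n)) = 2 * ereal (ln (real n))" by simp
        moreover have "(162 * a + 18 / b) * 2 = 324 * a + 36 / b"
          using that by (cases a; cases "b = 0"; cases b) auto
        ultimately show ?thesis by (metis mult.assoc)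
      qed
      moreover have "0 \<le> 1 / (e i)\<^sup>2" "0 \<le> (gen_inv (\<phi> i) (\<Delta> i / 2))\<^sup>2" for i
        by (cases "e i"; simp) (cases "gen_inv (\<phi> i) (\<Delta> i / 2)"; simp)
      ultimately show ?thesis
        using run[of "1 / (real n)\<^sup>2" n A] n A
        unfolding prob ln by (simp add: mult.assoc)
    qed
  qed
qed

end
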